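(* Let $d\ge 1$ be an integer and let $A(d)$ be the longest length of a monochromatic arithmetic progression of difference $d$ in the Thue--Morse word. If $d=2^n$ for some $n\ge 0$, then $A(d)=2$. If $d$ has an odd factor greater than $1$, then $A(d)\geq 4$. Further, there exists $d$ for which $A(d)=4$.
   Context: The Thue--Morse word $\mathbf t=(t_i)_{i\ge0}=\mathtt{0110100110010110}\cdots$ is the fixed point starting with $\mathtt 0$ of the substitution $\mathtt 0\mapsto\mathtt{01},\ \mathtt 1\mapsto\mathtt{10}$; equivalently, $t_i$ is the parity of the number of $1$s in the binary expansion of $i$. A monochromatic arithmetic progression (MAP) of difference $d$ and length $\ell$ in $\mathbf t$ starting at position $i\ge0$ means $t_i=t_{i+d}=\cdots=t_{i+(\ell-1)d}$. For $d\ge1$, $A(d)$ is the maximum $\ell$ such that a MAP of difference $d$ and length $\ell$ occurs in $\mathbf t$ (with $A(d)=\infty$ if no finite maximum exists). *)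

theory Defs
  imports Complex_Main "HOL-Library.Extended_Nat"
begin

definition thue_morse :: "nat \<Rightarrow> nat" where
  "thue_morse i = card {k. bit i k} mod 2"

fun thue_morse_subst :: "nat \<Rightarrow> nat list" where
  "thue_morse_subst c = (if c = 0 then [0, 1] else [1, 0])"

text \<open>An infinite word \<open>w\<close> is fixed by a substitution whose images all have length 2 iff the
  image of the letter \<open>w i\<close> occupies positions \<open>2 * i\<close> and \<open>2 * i + 1\<close> of \<open>w\<close>.\<close>

lemma thue_morse_fixed_point:
  "thue_morse 0 = 0"
  "[thue_morse (2 * i), thue_morse (2 * i + 1)] = thue_morse_subst (thue_morse i)"
proof -
  show "thue_morse 0 = 0" by (simp add: thue_morse_def)
  have fin: "finite {k. bit n k}" for n :: nat
  proof (rule finite_subset)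
    show "{k. bit n k} \<subseteq> {..<n}"
      by (auto simp: bit_iff_odd) (metis div_less even_zero less_exp not_less order_le_less_trans)
  qed simp
  have inj: "card (Suc ` S) = card S" for S by (simp add: card_image)
  have b0: "{k. bit (2 * i) k} = Suc ` {k. bit i k}"
    by (rule set_eqI, rename_tac k, case_tac k) (auto simp: bit_Suc bit_0)
  have b1: "{k. bit (2 * i + 1) k} = insert 0 (Suc ` {k. bit i k})"
    by (rule set_eqI, rename_tac k, case_tac k) (auto simp: bit_Suc bit_0)
  have "thue_morse (2 * i) = thue_morse i"
    unfolding thue_morse_def b0 inj ..
  moreover have "thue_morse (2 * i + 1) = Suc (card {k. bit i k}) mod 2"
    unfolding thue_morse_def b1 using fin[of i] by (subst card_insert_disjoint) (auto simp: inj)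
  ultimately show "[thue_morse (2 * i), thue_morse (2 * i + 1)] = thue_morse_subst (thue_morse i)"
    by (simp add: thue_morse_def mod_Suc)
qed

definition thue_morse_MAP :: "nat \<Rightarrow> nat \<Rightarrow> nat \<Rightarrow> bool" where
  "thue_morse_MAP i d l \<longleftrightarrow> (\<forall>j<l. thue_morse (i + j * d) = thue_morse i)"

text \<open>In \<open>enat\<close>, the supremum of a finite nonempty set is its maximum, and the supremum of an
  infinite set is \<open>\<infinity>\<close>; the set below always contains \<open>1\<close>.\<close>

definition A :: "nat \<Rightarrow> enat" where
  "A d = Sup {enat l | l. \<exists>i. thue_morse_MAP i d l}"

end

theory Submission
  imports Defs
begin

text \<open>
  Since \<open>t (2 * i) = t i\<close>, only the odd part of \<open>d\<close> matters for lower bounds. For odd \<open>d > 1\<close>, place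
  the progression across a multiple \<open>M\<close> of a large power of 4: to the right of \<open>M\<close> one reads a
  copy of \<open>t\<close> and to the left a mirror image of \<open>t\<close>, each possibly complemented, and the relative
  complementation can be prescribed. So four terms with one or two of them left of \<open>M\<close> only have to
  be monochromatic on each side separately. If \<open>t d = 0\<close>, then \<open>0, d, 2 * d\<close> can be put
  on the right. Otherwise \<open>d = 2 ^ (v + 1) * u + 1\<close> with \<open>u\<close> odd and \<open>t u = 0\<close>, and a suitable first
  term \<open>r < d\<close> right of \<open>M\<close> is \<open>2 ^ (v + 1)\<close>, \<open>1\<close> or \<open>2 ^ (v + 2) + 2\<close>, according to
  \<open>t (u + 1)\<close> and \<open>v\<close>. For \<open>d = 2 ^ n\<close>, three terms in progression lie at the same place of
  three consecutive blocks of length \<open>2 ^ n\<close>, so they would give a cube of a letter in \<open>t\<close>. The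
  bound 4 is attained at \<open>d = 11\<close>.
\<close>

section \<open>Digit parity on blocks and their mirror images\<close>

text \<open>As a Boolean, the parity turns complementing into negation and addition mod 2 into
  \<open>\<noteq>\<close>.\<close>

definition T :: "nat \<Rightarrow> bool" where
  "T n \<longleftrightarrow> thue_morse n = 1"

lemma thue_morse_cases: "thue_morse n = 0 \<or> thue_morse n = 1"
  unfolding thue_morse_def by linarith

lemma thue_morse_eq_iff: "thue_morse m = thue_morse n \<longleftrightarrow> T m = T n"
  using thue_morse_cases[of m] thue_morse_cases[of n] by (auto simp: T_def)

lemma T_0 [simp]: "\<not> T 0"
  by (simp add: T_def thue_morse_fixed_point(1))

lemma T_double [simp]: "T (2 * n) = T n"
  and T_double_Suc [simp]: "T (Suc (2 * n)) \<longleftrightarrow> \<not> T n"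
  using thue_morse_fixed_point(2)[of n] thue_morse_cases[of n] by (auto simp: T_def split: if_splits)

lemma T_numeral [simp]:
  "T 1" "T (Suc 0)"
  "T (numeral (num.Bit0 k)) = T (numeral k)"
  "T (numeral (num.Bit1 k)) \<longleftrightarrow> \<not> T (numeral k)"
proof -
  show "T 1" "T (Suc 0)"
    using T_double_Suc[of 0] by simp_all
  show "T (numeral (num.Bit0 k)) = T (numeral k)"
    using T_double[of "numeral k"] by simp
  have "numeral (num.Bit1 k) = Suc (2 * numeral k)"
    by (simp add: numeral_Bit1)
  then show "T (numeral (num.Bit1 k)) \<longleftrightarrow> \<not> T (numeral k)"
    using T_double_Suc[of "numeral k"] by simp
qed

text \<open>The binary digits of \<open>x\<close> lie below those of \<open>2 ^ k * h\<close>, so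
  the digit sums add.\<close>

lemma T_block: "x < 2 ^ k \<Longrightarrow> T (2 ^ k * h + x) \<longleftrightarrow> T h \<noteq> T x"
proof (induction k arbitrary: x)
  case (Suc k)
  define y where "y = x div 2"
  have "y < 2 ^ k" using Suc.prems by (auto simp: y_def)
  note IH = Suc.IH[OF this]
  show ?case
  proof (cases "even x")
    case True
    then have "x = 2 * y" by (auto simp: y_def)
    moreover from this have "2 ^ Suc k * h + x = 2 * (2 ^ k * h + y)" by simp
    ultimately show ?thesis using IH by (simp only: T_double)
  next
    case False
    then have "x = Suc (2 * y)" by (auto simp: y_def elim: oddE)
    moreover from this have "2 ^ Suc k * h + x = Suc (2 * (2 ^ k * h + y))" by simp
    ultimately show ?thesis using IH by (simp only: T_double_Suc) blast
  qed
qed simp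

lemma T_power_mult [simp]: "T (2 ^ k * h) = T h"
  using T_block[of 0 k h] by simp

lemma T_power [simp]: "T (2 ^ k)"
  using T_power_mult[of k 1] by simp

text \<open>Subtracting from \<open>2 ^ k - 1\<close> flips all \<open>k\<close> digits, so the
  number of ones becomes \<open>k\<close> minus that of \<open>x\<close>.\<close>

lemma T_mirror: "x < 2 ^ k \<Longrightarrow> T (2 ^ k - 1 - x) \<longleftrightarrow> T x \<noteq> odd k"
proof (induction k arbitrary: x)
  case (Suc k)
  define y where "y = x div 2"
  have y: "y < 2 ^ k" using Suc.prems by (auto simp: y_def)
  note IH = Suc.IH[OF y]
  show ?case
  proof (cases "even x")
    case True
    then have x: "x = 2 * y" by (auto simp: y_def)
    have "2 ^ Suc k - 1 - x = Suc (2 * (2 ^ k - 1 - y))" using y x by simp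
    then show ?thesis using IH x by (simp only: T_double_Suc T_double) simp
  next
    case False
    then have x: "x = Suc (2 * y)" by (auto simp: y_def elim: oddE)
    have "2 ^ Suc k - 1 - x = 2 * (2 ^ k - 1 - y)" using y x by simp
    then show ?thesis using IH x by (simp only: T_double_Suc T_double) simp
  qed
qed simp

lemma T_mirror_centre:
  obtains M where "N \<le> M"
    and "\<And>x. x < N \<Longrightarrow> T (M + x) \<longleftrightarrow> \<not> T x"
    and "\<And>x. x < N \<Longrightarrow> T (M - Suc x) \<longleftrightarrow> T x \<noteq> s"
proof -
  \<comment> \<open>\<open>T h\<close> holds for both choices, but \<open>T\<close> differs at their
    predecessors 1 and 0, so \<open>s\<close> can be prescribed.\<close>
  define h where "h = (if s then 2 else 1 :: nat)"
  have h: "h \<ge> 1" "T h" "T (h - 1) = s"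
    by (auto simp: h_def)
  \<comment> \<open>The even exponent keeps the mirror image of a block uncomplemented.\<close>
  define q where "q = (2::nat) ^ (2 * N)"
  have "N \<le> 2 * N" by simp
  also have "\<dots> < q" unfolding q_def by (rule less_exp)
  finally have N: "N < q" .
  show thesis
  proof
    show "N \<le> q * h" using N h(1) by (simp add: less_imp_le order.trans[OF _ mult_le_mono2[OF h(1)]])
    fix x assume x: "x < N"
    show "T (q * h + x) \<longleftrightarrow> \<not> T x"
      using T_block[of x "2 * N" h] x N h by (simp add: q_def)
    have "q * h = q * (h - 1) + q"
      using h(1) by (cases h) auto
    then have "q * h - Suc x = q * (h - 1) + (q - 1 - x)"
      using x N by simp
    moreover have "T (q * (h - 1) + (q - 1 - x)) \<longleftrightarrow> s \<noteq> T (q - 1 - x)"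
      using T_block[of "q - 1 - x" "2 * N" "h - 1"] x N h by (simp add: q_def)
    moreover have "T (q - 1 - x) = T x"
      using T_mirror[of x "2 * N"] x N by (simp add: q_def)
    ultimately show "T (q * h - Suc x) \<longleftrightarrow> T x \<noteq> s" by auto
  qed
qed

lemma thue_morse_MAP_iff: "thue_morse_MAP i d l \<longleftrightarrow> (\<forall>j<l. T (i + j * d) = T i)"
  by (simp add: thue_morse_MAP_def thue_morse_eq_iff)

lemma thue_morse_MAP_3_iff:
  "thue_morse_MAP i d 3 \<longleftrightarrow> T (i + d) = T i \<and> T (i + 2 * d) = T i"
proof -
  have "(\<forall>j<3. P j) \<longleftrightarrow> P 0 \<and> P 1 \<and> P 2" for P :: "nat \<Rightarrow> bool"
    by (auto simp: All_less_Suc eval_nat_numeral)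
  then show ?thesis by (simp add: thue_morse_MAP_iff)
qed

lemma thue_morse_MAP_4_iff:
  "thue_morse_MAP i d 4 \<longleftrightarrow> T (i + d) = T i \<and> T (i + 2 * d) = T i \<and> T (i + 3 * d) = T i"
proof -
  have "(\<forall>j<4. P j) \<longleftrightarrow> P 0 \<and> P 1 \<and> P 2 \<and> P 3" for P :: "nat \<Rightarrow> bool"
    by (auto simp: All_less_Suc eval_nat_numeral)
  then show ?thesis by (simp add: thue_morse_MAP_iff)
qed

lemma A_ge: "thue_morse_MAP i d l \<Longrightarrow> enat l \<le> A d"
  unfolding A_def by (rule Sup_upper) blast

text \<open>An initial part of a progression is again one, so excluding one length excludes all
  longer ones.\<close>

lemma A_le:
  assumes "\<And>i. \<not> thue_morse_MAP i d (Suc l)"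
  shows "A d \<le> enat l"
  unfolding A_def
proof (rule Sup_least, clarsimp)
  fix k i assume "thue_morse_MAP i d k"
  then show "k \<le> l"
    using assms[of i] unfolding thue_morse_MAP_def by (meson less_le_trans not_less_eq_eq)
qed

section \<open>Differences that are powers of two\<close>

text \<open>Two of the three positions are \<open>2 * g\<close> and \<open>2 * g + 1\<close> for
  some \<open>g\<close>, where the letters differ.\<close>

lemma not_three_T_equal: "\<not> (T (Suc h) = T h \<and> T (Suc (Suc h)) = T h)"
proof (cases "even h")
  case True
  then show ?thesis by (auto elim!: evenE)
next
  case False
  then obtain g where "h = Suc (2 * g)" by (auto elim: oddE)
  then have "Suc h = 2 * Suc g" by simp
  then have "T (Suc (Suc h)) \<longleftrightarrow> \<not> T (Suc h)" by (simp only: T_double_Suc T_double)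
  then show ?thesis by auto
qed

lemma A_power_of_two: "A (2 ^ n) = 2"
proof (rule antisym)
  have "A (2 ^ n) \<le> enat 2"
  proof (rule A_le)
    fix i :: nat
    define h r :: nat where "h = i div 2 ^ n" and "r = i mod 2 ^ n"
    have i: "i = 2 ^ n * h + r" and r: "r < 2 ^ n"
      by (simp_all add: h_def r_def)
    have "i + 2 ^ n = 2 ^ n * Suc h + r" "i + 2 * 2 ^ n = 2 ^ n * Suc (Suc h) + r"
      using i by simp_all
    then have "T (i + 2 ^ n) \<longleftrightarrow> T (Suc h) \<noteq> T r" "T (i + 2 * 2 ^ n) \<longleftrightarrow> T (Suc (Suc h)) \<noteq> T r"
      using T_block[OF r] by (simp_all only:)
    moreover have "T i \<longleftrightarrow> T h \<noteq> T r"
      using T_block[OF r] i by simp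
    ultimately have "\<not> thue_morse_MAP i (2 ^ n) 3"
      unfolding thue_morse_MAP_3_iff using not_three_T_equal[of h] by auto
    then show "\<not> thue_morse_MAP i (2 ^ n) (Suc 2)" by simp
  qed
  then show "A (2 ^ n) \<le> 2" by (simp add: numeral_eq_enat)
next
  \<comment> \<open>\<open>2 ^ n\<close> and its double each have a single binary digit 1.\<close>
  have "T (2 ^ n + 2 ^ n)"
    using T_power[of "Suc n"] by (simp only: power_Suc mult_2)
  then have "thue_morse_MAP (2 ^ n) (2 ^ n) 2"
    by (auto simp: thue_morse_MAP_iff less_2_cases_iff)
  from A_ge[OF this] show "2 \<le> A (2 ^ n)" by (simp add: numeral_eq_enat)
qed

section \<open>Four equal terms for odd differences\<close>

text \<open>The first term has mirrored index \<open>d - 1 - r\<close> left of the centre; the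
  others are at \<open>r\<close>, \<open>r + d\<close>, \<open>r + 2 * d\<close> right of it. The
  free complementation matches both sides.\<close>

lemma MAP_4_one_left:
  assumes "r < d" "T (r + d) = T r" "T (r + 2 * d) = T r"
  shows "\<exists>i. thue_morse_MAP i d 4"
proof -
  obtain M where M: "3 * d \<le> M" "\<And>x. x < 3 * d \<Longrightarrow> T (M + x) \<longleftrightarrow> \<not> T x"
    "\<And>x. x < 3 * d \<Longrightarrow> T (M - Suc x) \<longleftrightarrow> T x \<noteq> (T (d - 1 - r) = T r)"
    using T_mirror_centre[of "3 * d" "T (d - 1 - r) = T r"] by metis
  define i where "i = M - Suc (d - 1 - r)"
  have Ti: "T i \<longleftrightarrow> \<not> T r"
    using M(3)[of "d - 1 - r"] assms(1) by (auto simp: i_def)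
  have eqs: "i + d = M + r" "i + 2 * d = M + (r + d)" "i + 3 * d = M + (r + 2 * d)"
    using assms(1) M(1) by (simp_all add: i_def)
  have "thue_morse_MAP i d 4"
    unfolding thue_morse_MAP_4_iff eqs Ti
    using M(2)[of r] M(2)[of "r + d"] M(2)[of "r + 2 * d"] assms
    by auto
  then show ?thesis ..
qed

text \<open>With two terms on each side of the centre, equality within each side suffices.\<close>

lemma MAP_4_two_left:
  assumes "r < d" "T (r + d) = T r" "T (2 * d - 1 - r) = T (d - 1 - r)"
  shows "\<exists>i. thue_morse_MAP i d 4"
proof -
  obtain M where M: "3 * d \<le> M" "\<And>x. x < 3 * d \<Longrightarrow> T (M + x) \<longleftrightarrow> \<not> T x"
    "\<And>x. x < 3 * d \<Longrightarrow> T (M - Suc x) \<longleftrightarrow> T x \<noteq> (T (d - 1 - r) = T r)"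
    using T_mirror_centre[of "3 * d" "T (d - 1 - r) = T r"] by metis
  define i where "i = M - Suc (2 * d - 1 - r)"
  have Ti: "T i \<longleftrightarrow> \<not> T r"
    using M(3)[of "2 * d - 1 - r"] assms by (auto simp: i_def)
  have eqs: "i + d = M - Suc (d - 1 - r)" "i + 2 * d = M + r" "i + 3 * d = M + (r + d)"
    using assms(1) M(1) by (simp_all add: i_def)
  have "thue_morse_MAP i d 4"
    unfolding thue_morse_MAP_4_iff eqs Ti
    using M(3)[of "d - 1 - r"] M(2)[of r] M(2)[of "r + d"] assms
    by auto
  then show ?thesis ..
qed

lemma power_of_two_times_odd:
  fixes n :: nat
  assumes "n > 0"
  obtains v u where "n = 2 ^ v * u" "odd u"
  using assms
proof (induction n arbitrary: thesis rule: less_induct)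
  case (less n)
  show ?case
  proof (cases "even n")
    case True
    then obtain k where k: "n = 2 * k" by (elim evenE)
    with less.prems(2) have "k < n" "k > 0" by auto
    from less.IH[OF this(1) _ this(2)] obtain v u where "k = 2 ^ v * u" "odd u" by blast
    with k show thesis by (intro less.prems(1)[of "Suc v" u]) simp_all
  next
    case False
    then show thesis by (intro less.prems(1)[of 0 n]) simp_all
  qed
qed

lemma MAP_4_odd:
  assumes "odd d" "d > 1"
  shows "\<exists>i. thue_morse_MAP i d 4"
proof (cases "T d")
  case False
  then show ?thesis using assms by (intro MAP_4_one_left[of 0]) auto
next
  case True
  from assms(1) obtain e where d: "d = Suc (2 * e)" by (auto elim: oddE)
  have "e > 0" using assms(2) d by simp
  then obtain v u where e: "e = 2 ^ v * u" and "odd u"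
    by (rule power_of_two_times_odd)
  then obtain w where u: "u = Suc (2 * w)" by (auto elim: oddE)
  have "\<not> T e" using True d by simp
  then have Tu: "\<not> T u" by (simp add: e)
  then have Tw: "T w" by (simp add: u)
  have e_ge: "2 ^ v \<le> e" by (simp add: e u)
  consider (a) "\<not> T (Suc u)" | (b) "T (Suc u)" "v = 0" | (c) "T (Suc u)" "v > 0" by blast
  then show ?thesis
  proof cases
    case a
    \<comment> \<open>As \<open>d = 2 ^ (v + 1) * u + 1\<close>, this shift replaces
      \<open>u\<close> by \<open>u + 1\<close> on the right and by \<open>u - 1\<close> and
      \<open>2 * u - 1\<close> on the left; \<open>T\<close> holds at all four indices.\<close>
    let ?r = "2 * 2 ^ v :: nat"
    have "?r + d = Suc (2 * (2 ^ v * Suc u))" by (simp add: d e)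
    then have "T (?r + d)" using a by (simp only: T_double_Suc T_power_mult) simp
    moreover have "d - 1 - ?r = 2 * (2 ^ v * (2 * w))" by (simp add: d e u algebra_simps)
    then have "T (d - 1 - ?r)" using Tw by (simp only: T_double T_power_mult)
    moreover have "2 * d - 1 - ?r = Suc (2 * (2 ^ v * Suc (2 * (2 * w))))"
      by (simp add: d e u algebra_simps)
    then have "T (2 * d - 1 - ?r)" using Tw
      by (simp only: T_double T_double_Suc T_power_mult) simp
    ultimately show ?thesis
      using e_ge by (intro MAP_4_two_left[of ?r]) (simp_all add: d)
  next
    case b
    have "1 + d = 2 * Suc u" by (simp add: d e b)
    then have "T (1 + d)" using b by (simp only: T_double)
    moreover have "d - 1 - 1 = Suc (2 * (2 * w))" by (simp add: d e b u)
    then have "\<not> T (d - 1 - 1)" using Tw by (simp only: T_double_Suc T_double) simp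
    moreover have "2 * d - 1 - 1 = 2 * (2 * u)" by (simp add: d e b)
    then have "\<not> T (2 * d - 1 - 1)" using Tu by (simp only: T_double) simp
    ultimately show ?thesis
      using assms(2) by (intro MAP_4_two_left[of 1]) simp_all
  next
    case c
    have "T (2 * Suc w)" using c(1) by (simp add: u)
    then have Tw1: "T (Suc w)" by (simp only: T_double)
    \<comment> \<open>Equal letters at \<open>w\<close> and \<open>w + 1\<close> cannot start at an
      even position.\<close>
    have "odd w"
    proof
      assume "even w"
      then obtain z where "w = 2 * z" by (elim evenE)
      then show False using Tw Tw1 by simp
    qed
    then obtain z where w: "w = Suc (2 * z)" by (auto elim: oddE)
    have "Suc w = 2 * Suc z" by (simp add: w)
    then have Tz1: "T (Suc z)" using Tw1 by (simp only: T_double)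
    obtain k where v: "v = Suc k" using c(2) gr0_implies_Suc by blast
    \<comment> \<open>Here \<open>u = 4 * z + 3\<close>. The three right terms have remainders 2, 3,
      4 modulo powers of 2 that exceed them because \<open>v > 0\<close>.\<close>
    let ?r = "2 ^ (v + 2) + 2 :: nat"
    have k: "(2::nat) ^ k \<ge> 1" by simp
    have bounds: "2 < (2::nat) ^ (v + 2)" "3 < (2::nat) ^ (v + 1)" "4 < (2::nat) ^ (v + 2)"
      using k
      by (simp_all only: v power_add power_Suc power_one_right power2_eq_square)
    have "Suc 0 < 4 * 2 ^ k" using k by linarith
    then have "?r < d"
      by (simp add: d e u w v algebra_simps trans_less_add1)
    have "?r = 2 ^ (v + 2) * 1 + 2" by simp
    then have "\<not> T ?r"
      using T_block[OF bounds(1), of 1] by (simp only:) simp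
    moreover have "?r + d = 2 ^ (v + 1) * Suc (2 * (2 * Suc z)) + 3"
      by (simp add: d e u w algebra_simps)
    then have "\<not> T (?r + d)"
      using T_block[OF bounds(2)] Tz1 by (simp only: T_double_Suc T_double) simp
    moreover have "?r + 2 * d = 2 ^ (v + 2) * Suc u + 4"
      by (simp add: d e u w algebra_simps)
    then have "\<not> T (?r + 2 * d)"
      using T_block[OF bounds(3)] c(1) by (simp only:) simp
    ultimately show ?thesis
      using \<open>?r < d\<close> by (intro MAP_4_one_left[of ?r]) simp_all
  qed
qed

lemma A_ge_4:
  assumes "odd m" "m > 1" "m dvd d" "d \<ge> 1"
  shows "A d \<ge> 4"
proof -
  obtain a q where d: "d = 2 ^ a * q" and "odd q"
    using power_of_two_times_odd[of d] assms(4) by auto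
  have "q \<noteq> 1"
  proof
    assume "q = 1"
    with d assms(3) have "m dvd 2 ^ a" by simp
    moreover have "coprime m (2 ^ a)" using assms(1) by simp
    ultimately have "m = 1" by (metis coprime_absorb_left nat_dvd_1_iff_1)
    with assms(2) show False by simp
  qed
  moreover have "q \<noteq> 0" using \<open>odd q\<close> by (intro notI) simp
  ultimately obtain i where i: "thue_morse_MAP i q 4"
    using MAP_4_odd[OF \<open>odd q\<close>] by auto
  \<comment> \<open>Multiplying by \<open>2 ^ a\<close> only appends binary zeros.\<close>
  have "T (2 ^ a * i + j * d) = T (i + j * q)" for j
    using T_power_mult[of a "i + j * q"] by (simp add: d algebra_simps)
  then have "thue_morse_MAP (2 ^ a * i) d 4"
    using i by (simp add: thue_morse_MAP_iff)
  from A_ge[OF this] show ?thesis by (simp add: numeral_eq_enat)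
qed

section \<open>The difference 11\<close>

text \<open>As \<open>63 + 4 * 11 < 128\<close>, five terms of difference 11 meet at most two consecutive blocks of
  length 64; both values of \<open>t h + t (h + 1)\<close> have to be excluded.\<close>

lemma no_MAP_5_of_difference_11: "\<not> thue_morse_MAP i 11 5"
proof
  assume MAP: "thue_morse_MAP i 11 5"
  define h r where "h = i div 64" and "r = i mod 64"
  have i: "i = 64 * h + r" and r: "r < 64"
    by (simp_all add: h_def r_def)
  have T64: "T (64 * h + x) \<longleftrightarrow> (if x < 64 then T h \<noteq> T x else T (Suc h) \<noteq> T (x - 64))"
    if "x < 128" for x
    using T_block[of x 6 h] T_block[of "x - 64" 6 "Suc h"] that
    by (cases "x < 64") (auto simp: add.assoc)
  have eq: "T (64 * h + (r + j * 11)) = T (64 * h + r)" if "j \<in> {1, 2, 3, 4}" for j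
  proof -
    have "j < 5" using that by auto
    then show ?thesis using MAP by (simp add: thue_morse_MAP_iff i add.assoc)
  qed
  \<comment> \<open>\<open>s\<close> and \<open>s'\<close> stand for \<open>T h\<close> and
    \<open>T (Suc h)\<close>; all four combinations are evaluated at all 64 remainders.\<close>
  have "\<forall>x\<in>set [0..<64]. \<not> (\<forall>j\<in>{1, 2, 3, 4}.
      (if x + j * 11 < 64 then s \<noteq> T (x + j * 11) else s' \<noteq> T (x + j * 11 - 64)) =
      (s \<noteq> T x))" for s s'
    by (cases s; cases s') (simp_all add: upt_conv_Cons numeral_2_eq_2 [symmetric] del: set_upt)
  moreover have "\<forall>j\<in>{1, 2, 3, 4}.
      (if r + j * 11 < 64 then T h \<noteq> T (r + j * 11) else T (Suc h) \<noteq> T (r + j * 11 - 64)) =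
      (T h \<noteq> T r)"
  proof
    fix j :: nat
    assume j: "j \<in> {1, 2, 3, 4}"
    then have "r + j * 11 < 128" using r by auto
    from T64[OF this] T64[of r] eq[OF j] r
    show "(if r + j * 11 < 64 then T h \<noteq> T (r + j * 11) else T (Suc h) \<noteq> T (r + j * 11 - 64)) =
      (T h \<noteq> T r)" by simp
  qed
  ultimately show False using r by fastforce
qed

lemma A_11: "A 11 = 4"
proof (rule antisym)
  have "A 11 \<le> enat 4"
    by (rule A_le) (simp add: no_MAP_5_of_difference_11)
  then show "A 11 \<le> 4" by (simp add: numeral_eq_enat)
  show "A 11 \<ge> 4" by (rule A_ge_4[of 11]) simp_all
qed

theorem proposition3p3:
  "(\<forall>d\<ge>1. (\<exists>n. d = 2 ^ n) \<longrightarrow> A d = 2)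
   \<and> (\<forall>d\<ge>1. (\<exists>m. odd m \<and> m > 1 \<and> m dvd d) \<longrightarrow> A d \<ge> 4)
   \<and> (\<exists>d\<ge>1. A d = 4)"
proof (intro conjI)
  show "\<exists>d\<ge>1. A d = 4" using A_11 by (intro exI[of _ 11]) simp
qed (use A_power_of_two A_ge_4 in blast)+

end
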